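(* Let $\{A(t)\}_{t\ge0}$ be a continuous time chain of $N\times N$ matrices. Then $\{A(t)\}$ is full-rank, i.e. $\mathbf{rank}(A)=N$, if and only if $\{A(t)\}$ is an $l_1$-approximation of the neutral chain, i.e. the chain constantly equal to the zero matrix $\mathbf 0_{N\times N}$.
   Context: A continuous time chain $\{A(t)\}_{t\ge0}$ is a family of real $N\times N$ matrices with zero row sums and non-negative off-diagonal entries, whose entries are measurable and locally integrable functions of $t\in[0,\infty)$. Let $\Phi(t,\tau)$, $t\ge\tau\ge0$, be the state transition matrix of $\dot x(t)=A(t)x(t)$, so $x(t)=\Phi(t,\tau)x(\tau)$; it is invertible and row-stochastic. Rank: for $\tau\ge0$ let $\mathbf{null}_\tau(A)=\{v\in\mathbb R^N : \lim_{t\to\infty}\Phi(t,\tau)v=\mathbf 0_N\}$. This is a vector space whose dimension does not depend on $\tau$; this dimension is $\mathbf{nullity}(A)$, and $\mathbf{rank}(A)=N-\mathbf{nullity}(A)$. $\{A(t)\}$ is an $l_1$-approximation of $\{B(t)\}$ if $\int_0^\infty\|A(t)-B(t)\|\,dt<\infty$, where $\|\cdot\|$ is the maximum of the absolute values of the matrix entries. *)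

theory Defs
  imports "HOL-Analysis.Analysis"
begin

text \<open>
  Matrix functions have type \<^typ>\<open>real \<Rightarrow> real^'n^'n\<close>, the dimension being \<open>CARD('n)\<close>.  Only
  their values at times \<open>t \<ge> 0\<close> matter below.
\<close>

text \<open>
  Absolute integrability is Lebesgue integrability (it includes Lebesgue measurability),
  so the first conjunct says that the entries are measurable and locally integrable on
  \<open>[0,\<infinity>)\<close>.
\<close>

definition continuous_time_chain :: "(real \<Rightarrow> real^'n^'n) \<Rightarrow> bool" where
  "continuous_time_chain A \<longleftrightarrow>
     (\<forall>i j. \<forall>T\<ge>0. (\<lambda>t. A t $ i $ j) absolutely_integrable_on {0..T}) \<and>
     (\<forall>t\<ge>0. \<forall>i. (\<Sum>j\<in>UNIV. A t $ i $ j) = 0) \<and>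
     (\<forall>t\<ge>0. \<forall>i j. i \<noteq> j \<longrightarrow> A t $ i $ j \<ge> 0)"

text \<open>
  The entries of \<open>A\<close> are only locally integrable, so the initial value problem \<open>X' = A X\<close>,
  \<open>X(\<tau>) = I\<close> on \<open>[\<tau>,\<infinity>)\<close> is meant in the sense of Caratheodory, i.e. through the
  equivalent integral equation.
\<close>

definition fundamental_solution ::
    "(real \<Rightarrow> real^'n^'n) \<Rightarrow> real \<Rightarrow> (real \<Rightarrow> real^'n^'n) \<Rightarrow> bool" where
  "fundamental_solution A \<tau> X \<longleftrightarrow>
     continuous_on {\<tau>..} X \<and>
     (\<forall>t\<ge>\<tau>. ((\<lambda>s. A s ** X s) has_integral (X t - mat 1)) {\<tau>..t})"

text \<open>
  The state transition matrix \<open>\<Phi>(t,\<tau>)\<close>, for \<open>t \<ge> \<tau> \<ge> 0\<close>.  The description selects the value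
  \<open>X t\<close> rather than the function \<open>X\<close>, which is unconstrained to the left of \<open>\<tau>\<close>.
\<close>

definition state_transition ::
    "(real \<Rightarrow> real^'n^'n) \<Rightarrow> real \<Rightarrow> real \<Rightarrow> real^'n^'n" where
  "state_transition A t \<tau> = (THE M. \<exists>X. fundamental_solution A \<tau> X \<and> M = X t)"

definition null_at :: "(real \<Rightarrow> real^'n^'n) \<Rightarrow> real \<Rightarrow> (real^'n) set" where
  "null_at A \<tau> = {v. ((\<lambda>t. state_transition A t \<tau> *v v) \<longlongrightarrow> 0) at_top}"

text \<open>
  For a chain, the dimension of \<^term>\<open>null_at A \<tau>\<close> is the same for all \<open>\<tau> \<ge> 0\<close>, since
  \<open>\<Phi>(t,0) = \<Phi>(t,\<tau>) \<Phi>(\<tau>,0)\<close> with \<open>\<Phi>(\<tau>,0)\<close> invertible; it is taken at \<open>\<tau> = 0\<close>.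
\<close>

definition nullity :: "(real \<Rightarrow> real^'n^'n) \<Rightarrow> nat" where
  "nullity A = dim (null_at A 0)"

definition chain_rank :: "(real \<Rightarrow> real^'n^'n) \<Rightarrow> nat" where
  "chain_rank (A :: real \<Rightarrow> real^'n^'n) = CARD('n) - nullity A"

definition max_norm :: "real^'n^'n \<Rightarrow> real" where
  "max_norm M = Max {\<bar>M $ i $ j\<bar> | i j. True}"

definition l1_approximation ::
    "(real \<Rightarrow> real^'n^'n) \<Rightarrow> (real \<Rightarrow> real^'n^'n) \<Rightarrow> bool" where
  "l1_approximation A B \<longleftrightarrow> (\<lambda>t. max_norm (A t - B t)) absolutely_integrable_on {0..}"

definition neutral_chain :: "real \<Rightarrow> real^'n^'n" where
  "neutral_chain = (\<lambda>t. 0)"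

end

theory Submission
  imports Defs
begin

text \<open>
  Let \<open>X t = \<Phi>(t,0)\<close>.  Transition matrices are stochastic, so the sup norm of \<open>X t *v v\<close> is
  nonincreasing in \<open>t\<close>, and \<open>v\<close> lies in the null space as soon as \<open>X t *v v\<close> tends to \<open>0\<close> along
  one sequence of times.  As \<open>X\<close> is bounded, compactness shows that the null space is trivial iff
  \<open>det (X t)\<close> is bounded away from \<open>0\<close>: a singular limit point of \<open>X\<close> sends some \<open>v \<noteq> 0\<close> to \<open>0\<close>.
  By Liouville's formula \<open>det (X t)\<close> is the exponential of the integral of \<open>trace (A s)\<close> over
  \<open>{0..t}\<close>.  For a chain \<open>- trace (A s)\<close> is comparable to the norm of \<open>A s\<close>, so this bound says
  exactly that \<open>A\<close> is integrable on \<open>{0..}\<close>.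

  The coefficients are only locally integrable, so derivatives in time are replaced by right
  increments measured against \<open>\<phi> t\<close>, the integral of \<open>norm (A s)\<close> over \<open>{0..t}\<close>: a continuous
  function whose increments are \<open>o(\<phi> t - \<phi> s)\<close> is constant.
\<close>

section \<open>Monotonicity from right increments measured against a continuous function\<close>

lemma continuous_on_imp_tendsto_at_right:
  fixes f :: "real \<Rightarrow> 'a::topological_space"
  assumes "continuous_on {a..b} f" "a \<le> s" "s < b"
  shows "(f \<longlongrightarrow> f s) (at_right s)"
  by (rule continuous_on_Icc_at_rightD[of s b]) (use assms in \<open>auto elim: continuous_on_subset\<close>)

text \<open>For fixed \<open>e > 0\<close>, the function \<open>G = H - e * \<phi>\<close> does not
  exceed \<open>G s\<close> immediately to the right of any \<open>s\<close>. The set of times with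
  \<open>G t \<le> G a\<close> is closed, so it contains its supremum, which therefore cannot lie
  before \<open>b\<close>. Letting \<open>e\<close> tend to 0 removes the correction.\<close>

lemma dini_antimono:
  fixes H \<phi> :: "real \<Rightarrow> real"
  assumes "a \<le> b" and cH: "continuous_on {a..b} H" and c\<phi>: "continuous_on {a..b} \<phi>"
    and dini: "\<And>s e. a \<le> s \<Longrightarrow> s < b \<Longrightarrow> e > 0 \<Longrightarrow>
                 \<forall>\<^sub>F t in at_right s. H t - H s \<le> e * (\<phi> t - \<phi> s)"
  shows "H b \<le> H a"
proof -
  have main: "H b - e * \<phi> b \<le> H a - e * \<phi> a" if "e > 0" for e
  proof -
    define G where "G = (\<lambda>t. H t - e * \<phi> t)"
    have cG: "continuous_on {a..b} G"
      unfolding G_def by (intro continuous_intros cH c\<phi>)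
    define S where "S = {t \<in> {a..b}. G t \<le> G a}"
    have "closed S"
      unfolding S_def by (intro closed_Collect_le continuous_on_closed_Collect_le cG) auto
    have "a \<in> S" using \<open>a \<le> b\<close> by (simp add: S_def)
    have bdd: "bdd_above S" by (auto simp: S_def)
    define c where "c = Sup S"
    have "c \<in> S"
      unfolding c_def using \<open>closed S\<close> \<open>a \<in> S\<close> bdd by (intro closed_contains_Sup) auto
    have "c = b"
    proof (rule ccontr)
      assume "c \<noteq> b"
      with \<open>c \<in> S\<close> have c: "a \<le> c" "c < b" "G c \<le> G a" by (auto simp: S_def)
      have "\<forall>\<^sub>F t in at_right c. G t \<le> G c"
        using dini[OF c(1,2) that] by eventually_elim (simp add: G_def algebra_simps)
      moreover have "\<forall>\<^sub>F t in at_right c. t \<in> {c<..<b}"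
        using c(2) by (rule eventually_at_right_real)
      ultimately have "\<forall>\<^sub>F t in at_right c. G t \<le> G c \<and> t \<in> {c<..<b}"
        by eventually_elim simp
      then obtain t where "G t \<le> G c" "c < t" "t < b"
        by (auto dest: eventually_happens'[OF trivial_limit_at_right_real])
      then have "t \<in> S" using c by (auto simp: S_def)
      then have "t \<le> c" unfolding c_def using bdd by (rule cSup_upper)
      with \<open>c < t\<close> show False by simp
    qed
    with \<open>c \<in> S\<close> show ?thesis by (simp add: S_def G_def)
  qed
  show ?thesis
  proof (rule field_le_epsilon)
    fix d :: real assume "d > 0"
    \<comment> \<open>The summand 1 keeps the denominator positive when
      \<open>\<phi> b = \<phi> a\<close>, and the correction is then at most
      \<open>d\<close>.\<close>
    define e where "e = d / (1 + \<bar>\<phi> b - \<phi> a\<bar>)"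
    have "e > 0" using \<open>d > 0\<close> by (simp add: e_def add_pos_nonneg)
    have "H b \<le> H a + e * (\<phi> b - \<phi> a)" using main[OF \<open>e > 0\<close>] by (simp add: algebra_simps)
    also have "e * (\<phi> b - \<phi> a) \<le> e * (1 + \<bar>\<phi> b - \<phi> a\<bar>)"
      using \<open>e > 0\<close> by (intro mult_left_mono) auto
    also have "\<dots> = d" by (simp add: e_def)
    finally show "H b \<le> H a + d" by simp
  qed
qed

lemma dini_const:
  fixes H \<phi> :: "real \<Rightarrow> real"
  assumes "a \<le> b" and cH: "continuous_on {a..b} H" and c\<phi>: "continuous_on {a..b} \<phi>"
    and dini: "\<And>s e. a \<le> s \<Longrightarrow> s < b \<Longrightarrow> e > 0 \<Longrightarrow>
                 \<forall>\<^sub>F t in at_right s. \<bar>H t - H s\<bar> \<le> e * (\<phi> t - \<phi> s)"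
  shows "H b = H a"
proof (rule antisym)
  show "H b \<le> H a"
  proof (rule dini_antimono[OF assms(1-3)])
    fix s e :: real assume "a \<le> s" "s < b" "e > 0"
    from dini[OF this] show "\<forall>\<^sub>F t in at_right s. H t - H s \<le> e * (\<phi> t - \<phi> s)"
      by eventually_elim auto
  qed
  have "- H b \<le> - H a"
  proof (rule dini_antimono[OF assms(1) continuous_on_minus[OF cH] c\<phi>])
    fix s e :: real assume "a \<le> s" "s < b" "e > 0"
    from dini[OF this] show "\<forall>\<^sub>F t in at_right s. - H t - - H s \<le> e * (\<phi> t - \<phi> s)"
      by eventually_elim auto
  qed
  then show "H a \<le> H b" by simp
qed

section \<open>Submultiplicativity of the Euclidean matrix norm\<close>

lemma norm_matrix_vector_mult_le: "norm (M *v v) \<le> norm M * norm v"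
  for M :: "real^'n^'m"
proof -
  have "norm (M *v v) \<le> L2_set (\<lambda>i. norm (M $ i) * norm v) UNIV"
    unfolding norm_vec_def[of "M *v v"]
    by (rule L2_set_mono) (simp_all add: matrix_vector_mul_component Cauchy_Schwarz_ineq2)
  also have "\<dots> = norm M * norm v"
    by (simp add: L2_set_left_distrib norm_vec_def[of M])
  finally show ?thesis .
qed

text \<open>Row \<open>i\<close> of the product combines the rows of \<open>X\<close> with
  coefficients \<open>M $ i $ k\<close>; the triangle inequality and Cauchy-Schwarz over
  \<open>k\<close> bound it. Here \<open>norm\<close> is the Euclidean norm of all entries, not
  \<open>max_norm\<close>.\<close>

lemma norm_matrix_mult_le: "norm (M ** X) \<le> norm M * norm X"
  for M :: "real^'n^'m" and X :: "real^'k^'n"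
proof -
  have row: "norm ((M ** X) $ i) \<le> norm (M $ i) * norm X" for i
  proof -
    have "(M ** X) $ i = (\<Sum>k\<in>UNIV. (M $ i $ k) *\<^sub>R X $ k)"
      by (simp add: vec_eq_iff matrix_matrix_mult_def)
    then have "norm ((M ** X) $ i) \<le> (\<Sum>k\<in>UNIV. \<bar>M $ i $ k\<bar> * norm (X $ k))"
      using norm_sum[of "\<lambda>k. (M $ i $ k) *\<^sub>R X $ k" UNIV] by simp
    also have "\<dots> \<le> L2_set (\<lambda>k. M $ i $ k) UNIV * L2_set (\<lambda>k. norm (X $ k)) UNIV"
      using L2_set_mult_ineq[of "\<lambda>k. M $ i $ k" "\<lambda>k. norm (X $ k)" UNIV] by simp
    also have "\<dots> = norm (M $ i) * norm X"
      by (simp add: norm_vec_def L2_set_def)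
    finally show ?thesis .
  qed
  have "norm (M ** X) \<le> L2_set (\<lambda>i. norm (M $ i) * norm X) UNIV"
    unfolding norm_vec_def[of "M ** X"] by (rule L2_set_mono) (simp_all add: row)
  also have "\<dots> = norm M * norm X"
    by (simp add: L2_set_left_distrib norm_vec_def[of M])
  finally show ?thesis .
qed

lemma bounded_bilinear_matrix_mult:
  "bounded_bilinear (\<lambda>(M::real^'n^'m) (X::real^'k^'n). M ** X)"
proof
  show "\<exists>K. \<forall>a b. norm ((a::real^'n^'m) ** (b::real^'k^'n)) \<le> norm a * norm b * K"
    by (rule exI[of _ 1]) (simp add: norm_matrix_mult_le)
qed (simp_all add: vec_eq_iff matrix_matrix_mult_def sum.distrib algebra_simps sum_distrib_left)

text \<open>Continuity is local: inside the neighbourhood \<open>{..<x+1}\<close> of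
  \<open>x\<close> the sets \<open>{a..x+1}\<close> and \<open>{a..}\<close> coincide.\<close>

lemma continuous_on_atLeast_iff:
  fixes f :: "real \<Rightarrow> 'a::topological_space"
  shows "continuous_on {a..} f \<longleftrightarrow> (\<forall>b\<ge>a. continuous_on {a..b} f)"
proof
  assume R: "\<forall>b\<ge>a. continuous_on {a..b} f"
  show "continuous_on {a..} f"
    unfolding continuous_on_eq_continuous_within
  proof
    fix x assume x: "x \<in> {a..}"
    then have "continuous (at x within {a..x+1}) f"
      using R continuous_on_eq_continuous_within[of "{a..x+1}" f] by simp
    moreover have "at x within {a..x+1} = at x within {a..}"
      by (rule at_within_nhd[of _ "{..<x+1}"]) auto
    ultimately show "continuous (at x within {a..}) f" by simp
  qed
qed (auto elim: continuous_on_subset)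

section \<open>Linear differential equations with locally integrable coefficients\<close>

text \<open>Existence of solutions and Liouville's formula are developed for general locally
  integrable coefficients; the structure of a chain comes in later. The integral
  \<open>\<phi>\<close> is the clock against which all increments are measured.\<close>

locale linear_ode =
  fixes A :: "real \<Rightarrow> real^'n^'n"
  assumes A_integrable: "\<And>T. A absolutely_integrable_on {0..T}"
begin

definition \<phi> :: "real \<Rightarrow> real" where "\<phi> t = integral {0..t} (\<lambda>s. norm (A s))"

lemma A_integrable_on: "0 \<le> s \<Longrightarrow> A absolutely_integrable_on {s..t}"
  by (rule absolutely_integrable_on_subinterval[OF A_integrable[of t]]) auto

lemma norm_A_integrable: "0 \<le> s \<Longrightarrow> (\<lambda>u. norm (A u)) integrable_on {s..t}"
  using A_integrable_on absolutely_integrable_on_def by blast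

lemma \<phi>_diff: "0 \<le> s \<Longrightarrow> s \<le> t \<Longrightarrow> \<phi> t - \<phi> s = integral {s..t} (\<lambda>u. norm (A u))"
  unfolding \<phi>_def
  using Henstock_Kurzweil_Integration.integral_combine[of 0 s t "\<lambda>u. norm (A u)"]
    norm_A_integrable by simp

lemma \<phi>_mono: "0 \<le> s \<Longrightarrow> s \<le> t \<Longrightarrow> \<phi> s \<le> \<phi> t"
  using \<phi>_diff[of s t] integral_nonneg[OF norm_A_integrable[of s t]] by simp

lemma continuous_on_\<phi>: "continuous_on {0..T} \<phi>"
  unfolding \<phi>_def by (intro indefinite_integral_continuous_1 norm_A_integrable) simp

lemma integral_diff_le:
  fixes f :: "real \<Rightarrow> 'a::euclidean_space"
  assumes st: "0 \<le> s" "s \<le> t" and f: "f integrable_on {0..t}"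
    and bound: "\<And>u. s \<le> u \<Longrightarrow> u \<le> t \<Longrightarrow> norm (f u) \<le> c * norm (A u)"
  shows "norm (integral {0..t} f - integral {0..s} f) \<le> c * (\<phi> t - \<phi> s)"
proof -
  have "integral {0..t} f - integral {0..s} f = integral {s..t} f"
    using Henstock_Kurzweil_Integration.integral_combine[OF st f] by (simp add: algebra_simps)
  also have "norm \<dots> \<le> integral {s..t} (\<lambda>u. c * norm (A u))"
  proof (rule integral_norm_bound_integral)
    show "f integrable_on {s..t}"
      by (rule integrable_subinterval_real[OF f]) (use st in auto)
    show "(\<lambda>u. c * norm (A u)) integrable_on {s..t}"
      using st by (intro integrable_on_mult_right norm_A_integrable)
  qed (use bound in auto)
  also have "\<dots> = c * (\<phi> t - \<phi> s)" using st by (simp add: \<phi>_diff)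
  finally show ?thesis .
qed

section \<open>Existence of the fundamental solution by the Picard series\<close>

lemma mult_integrable:
  fixes X :: "real \<Rightarrow> real^'n^'n"
  assumes "continuous_on {0..T} X"
  shows "(\<lambda>s. A s ** X s) absolutely_integrable_on {0..T}"
proof -
  \<comment> \<open>The bounded measurable factor is \<open>X\<close>, being continuous on a compact
    interval. It has to be the first argument, hence the flipped product.\<close>
  have "bilinear (\<lambda>(X::real^'n^'n) (M::real^'n^'n). M ** X)"
    using bounded_bilinear.flip[OF bounded_bilinear_matrix_mult]
    by (simp add: bilinear_conv_bounded_bilinear)
  then show ?thesis
    by (rule absolutely_integrable_bounded_measurable_product)
      (use assms in \<open>auto intro!: A_integrable continuous_imp_measurable_on_sets_lebesgue
          compact_imp_bounded compact_continuous_image\<close>)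
qed

text \<open>These are the terms of the Peano-Baker series rather than its partial sums:
  \<open>picard n\<close> is an n-fold iterated integral, and the solution is the sum over
  \<open>n\<close>.\<close>

fun picard :: "nat \<Rightarrow> real \<Rightarrow> real^'n^'n" where
  "picard 0 = (\<lambda>t. mat 1)"
| "picard (Suc n) = (\<lambda>t. integral {0..t} (\<lambda>s. A s ** picard n s))"

lemma continuous_on_picard: "continuous_on {0..T} (picard n)"
proof (induction n)
  case (Suc n)
  then show ?case
    by (auto intro!: indefinite_integral_continuous_1
        set_lebesgue_integral_eq_integral(1)[OF mult_integrable])
qed simp

lemma picard_integrable: "(\<lambda>s. A s ** picard n s) integrable_on {0..T}"
  by (intro set_lebesgue_integral_eq_integral(1)[OF mult_integrable] continuous_on_picard)

lemma norm_mult_exp_abs_integrable: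
  "(\<lambda>s. norm (A s) * exp (2 * \<phi> s)) absolutely_integrable_on {0..T}"
proof -
  have "(\<lambda>s. exp (2 * \<phi> s) * norm (A s)) absolutely_integrable_on {0..T}"
  proof (rule absolutely_integrable_bounded_measurable_product_real)
    have c: "continuous_on {0..T} (\<lambda>s. exp (2 * \<phi> s))"
      by (intro continuous_intros continuous_on_\<phi>)
    then show "(\<lambda>s. exp (2 * \<phi> s)) \<in> borel_measurable (lebesgue_on {0..T})"
      by (rule continuous_imp_measurable_on_sets_lebesgue) simp
    show "bounded ((\<lambda>s. exp (2 * \<phi> s)) ` {0..T})"
      using c by (intro compact_imp_bounded compact_continuous_image) auto
    show "(\<lambda>s. norm (A s)) absolutely_integrable_on {0..T}"
      using absolutely_integrable_norm[OF A_integrable] by (simp add: o_def)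
  qed simp
  then show ?thesis by (simp add: mult.commute)
qed

lemmas norm_mult_exp_integrable =
  set_lebesgue_integral_eq_integral(1)[OF norm_mult_exp_abs_integrable]

text \<open>The weight \<open>exp (2 * \<phi> t)\<close> makes the Picard operator a contraction with factor \<open>1/2\<close>.\<close>

lemma integral_norm_mult_exp_le:
  assumes "0 \<le> T"
  shows "integral {0..T} (\<lambda>s. norm (A s) * exp (2 * \<phi> s)) \<le> exp (2 * \<phi> T) / 2"
proof -
  define f where "f = (\<lambda>s. norm (A s) * exp (2 * \<phi> s))"
  have f: "f integrable_on {0..T}" for T
    unfolding f_def by (rule norm_mult_exp_integrable)
  \<comment> \<open>If \<open>\<phi>\<close> were differentiable, \<open>H\<close> would formally
    have derivative 0; \<open>dini_antimono\<close> replaces that computation. Since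
    \<open>H 0 = -1/2\<close>, the claim follows from \<open>H T \<le> H 0\<close>.\<close>
  define H where "H = (\<lambda>t. integral {0..t} f - exp (2 * \<phi> t) / 2)"
  have "H T \<le> H 0"
  proof (rule dini_antimono[OF \<open>0 \<le> T\<close> _ continuous_on_\<phi>])
    show "continuous_on {0..T} H"
      unfolding H_def
      by (intro continuous_intros indefinite_integral_continuous_1 f continuous_on_\<phi>) simp
    fix s e :: real assume s: "0 \<le> s" "s < T" and "e > 0"
    have "((\<lambda>t. exp (2 * \<phi> t)) \<longlongrightarrow> exp (2 * \<phi> s)) (at_right s)"
      by (intro tendsto_intros continuous_on_imp_tendsto_at_right[OF continuous_on_\<phi> s])
    then have "\<forall>\<^sub>F t in at_right s. exp (2 * \<phi> t) < exp (2 * \<phi> s) + e"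
      using \<open>e > 0\<close> by (auto dest: order_tendstoD(2)[of _ _ _ "exp (2 * \<phi> s) + e"])
    moreover have "\<forall>\<^sub>F t in at_right s. t \<in> {s<..<T}"
      using s(2) by (rule eventually_at_right_real)
    ultimately show "\<forall>\<^sub>F t in at_right s. H t - H s \<le> e * (\<phi> t - \<phi> s)"
    proof eventually_elim
      case (elim t)
      then have st: "s \<le> t" by simp
      have "norm (integral {0..t} f - integral {0..s} f) \<le> exp (2 * \<phi> t) * (\<phi> t - \<phi> s)"
      proof (rule integral_diff_le[OF s(1) st f])
        fix u assume "s \<le> u" "u \<le> t"
        then have "\<phi> u \<le> \<phi> t" using s by (intro \<phi>_mono) auto
        then show "norm (f u) \<le> exp (2 * \<phi> t) * norm (A u)"
          by (simp add: f_def abs_mult mult.commute[of _ "norm (A u)"] mult_left_mono)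
      qed
      \<comment> \<open>The inequality \<open>1 + x \<le> exp x\<close> bounds the growth of the
        exponential from below with the weight taken at \<open>s\<close>, whereas the integral was
        bounded with the weight at \<open>t\<close>. Close to \<open>s\<close> the two weights
        differ by less than \<open>e\<close>.\<close>
      moreover have "exp (2 * \<phi> s) * (2 * (\<phi> t - \<phi> s)) \<le> exp (2 * \<phi> t) - exp (2 * \<phi> s)"
      proof -
        have "exp (2 * \<phi> s) * (1 + 2 * (\<phi> t - \<phi> s)) \<le> exp (2 * \<phi> s) * exp (2 * (\<phi> t - \<phi> s))"
          by (intro mult_left_mono exp_ge_add_one_self) simp
        then show ?thesis by (simp add: exp_add[symmetric] algebra_simps)
      qed
      ultimately have "H t - H s \<le> (exp (2 * \<phi> t) - exp (2 * \<phi> s)) * (\<phi> t - \<phi> s)"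
        by (simp add: H_def algebra_simps)
      also have "\<dots> \<le> e * (\<phi> t - \<phi> s)"
        using elim s st by (intro mult_right_mono) (auto simp: \<phi>_mono)
      finally show ?case .
    qed
  qed
  then show ?thesis by (simp add: H_def \<phi>_def f_def)
qed

lemma norm_picard_le:
  "0 \<le> t \<Longrightarrow> norm (picard n t) \<le> norm (mat 1 :: real^'n^'n) * (1/2)^n * exp (2 * \<phi> t)"
proof (induction n arbitrary: t)
  case 0
  then have "0 \<le> \<phi> t" using \<phi>_mono[of 0 t] by (simp add: \<phi>_def)
  then show ?case by (simp add: mult_le_cancel_left1)
next
  case (Suc n)
  define C where "C = norm (mat 1 :: real^'n^'n) * (1/2)^n"
  have "norm (picard (Suc n) t) \<le> integral {0..t} (\<lambda>s. C * (norm (A s) * exp (2 * \<phi> s)))"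
    unfolding picard.simps
  proof (rule integral_norm_bound_integral[OF picard_integrable])
    show "(\<lambda>s. C * (norm (A s) * exp (2 * \<phi> s))) integrable_on {0..t}"
      by (intro integrable_on_mult_right norm_mult_exp_integrable)
    fix s assume "s \<in> {0..t}"
    then have "norm (picard n s) \<le> C * exp (2 * \<phi> s)"
      using Suc.IH[of s] by (simp add: C_def)
    then have "norm (A s) * norm (picard n s) \<le> norm (A s) * (C * exp (2 * \<phi> s))"
      by (intro mult_left_mono) auto
    then show "norm (A s ** picard n s) \<le> C * (norm (A s) * exp (2 * \<phi> s))"
      using norm_matrix_mult_le[of "A s" "picard n s"] by (simp add: algebra_simps)
  qed
  also have "\<dots> = C * integral {0..t} (\<lambda>s. norm (A s) * exp (2 * \<phi> s))" by simp
  also have "\<dots> \<le> C * (exp (2 * \<phi> t) / 2)"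
    by (intro mult_left_mono integral_norm_mult_exp_le Suc.prems) (simp add: C_def)
  finally show ?case by (simp add: C_def)
qed

text \<open>The initial value is left free so that a difference of solutions is again a solution,
  which the uniqueness proof exploits.\<close>

definition solution :: "(real \<Rightarrow> real^'n^'n) \<Rightarrow> bool" where
  "solution X \<longleftrightarrow> (\<forall>t\<ge>0. continuous_on {0..t} X \<and> X t - X 0 = integral {0..t} (\<lambda>s. A s ** X s))"

text \<open>The geometric bound on the Picard terms gives uniform convergence on compact intervals,
  hence a continuous sum. Dominated convergence then carries the integral equation from the partial
  sums to the limit.\<close>

lemma solution_exists: "\<exists>X. solution X \<and> X 0 = mat 1"
proof -
  define X where "X = (\<lambda>t. \<Sum>n. picard n t)"
  define C where "C = norm (mat 1 :: real^'n^'n)"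
  have bound: "norm (picard n s) \<le> C * exp (2 * \<phi> t) * (1/2)^n" if "0 \<le> s" "s \<le> t" for n s t
  proof -
    have "norm (picard n s) \<le> C * (1/2)^n * exp (2 * \<phi> s)"
      using norm_picard_le[OF that(1)] by (simp add: C_def)
    also have "\<dots> \<le> C * (1/2)^n * exp (2 * \<phi> t)"
      using \<phi>_mono[OF that] by (intro mult_left_mono) (auto simp: C_def)
    finally show ?thesis by (simp add: algebra_simps)
  qed
  have geo: "summable (\<lambda>n. c * (1/2)^n)" for c :: real
    by (intro summable_mult summable_geometric) simp
  have ul: "uniform_limit {0..t} (\<lambda>N s. \<Sum>n<N. picard n s) X sequentially" for t
    unfolding X_def by (rule Weierstrass_m_test[OF bound geo]) auto
  have contX: "continuous_on {0..t} X" for t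
    by (rule uniform_limit_theorem[OF _ ul])
      (auto intro!: always_eventually continuous_on_sum continuous_on_picard)
  have summ: "summable (\<lambda>n. picard n s)" if "0 \<le> s" for s
    by (rule summable_comparison_test'[OF geo bound]) (use that in auto)
  have "X 0 = mat 1"
  proof -
    have "X 0 = (\<Sum>n. if n = 0 then mat 1 else 0)"
      unfolding X_def
    proof (rule arg_cong[of _ _ suminf], rule ext)
      fix n show "picard n 0 = (if n = 0 then mat 1 else 0)" by (cases n) auto
    qed
    then show ?thesis using suminf_finite[of "{0::nat}" "\<lambda>n. if n = 0 then mat 1 else (0::real^'n^'n)"]
      by simp
  qed
  have "X t - X 0 = integral {0..t} (\<lambda>s. A s ** X s)" if "0 \<le> t" for t
  proof -
    \<comment> \<open>The geometric series sums to 2, so \<open>D\<close> bounds every partial sum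
      on \<open>{0..t}\<close>, and \<open>D * norm (A s)\<close> is the dominating
      function.\<close>
    define D where "D = 2 * C * exp (2 * \<phi> t)"
    have conv: "(\<lambda>N. \<Sum>n<N. picard n s) \<longlonglongrightarrow> X s" if "0 \<le> s" for s
      unfolding X_def by (rule summable_LIMSEQ[OF summ[OF that]])
    have psum: "norm (\<Sum>n<N. picard n s) \<le> D" if "0 \<le> s" "s \<le> t" for s N
    proof -
      have "norm (\<Sum>n<N. picard n s) \<le> (\<Sum>n<N. C * exp (2 * \<phi> t) * (1/2)^n)"
        by (rule sum_norm_le) (rule bound[OF that])
      also have "\<dots> \<le> (\<Sum>n. C * exp (2 * \<phi> t) * (1/2)^n)"
        by (rule sum_le_suminf[OF geo]) (auto simp: C_def)
      also have "\<dots> = D" by (simp add: suminf_mult suminf_geometric summable_geometric D_def)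
      finally show ?thesis .
    qed
    have mult_sum: "A s ** (\<Sum>n<N. picard n s) = (\<Sum>n<N. A s ** picard n s)" for s N
      by (rule bounded_bilinear.sum_right[OF bounded_bilinear_matrix_mult])
    have lim: "(\<lambda>N. integral {0..t} (\<lambda>s. A s ** (\<Sum>n<N. picard n s)))
            \<longlonglongrightarrow> integral {0..t} (\<lambda>s. A s ** X s)"
    proof (rule dominated_convergence(2))
      show "(\<lambda>s. A s ** (\<Sum>n<N. picard n s)) integrable_on {0..t}" for N
        unfolding mult_sum by (intro integrable_sum picard_integrable) auto
      show "(\<lambda>s. D * norm (A s)) integrable_on {0..t}"
        by (intro integrable_on_mult_right norm_A_integrable) simp
      show "norm (A s ** (\<Sum>n<N. picard n s)) \<le> D * norm (A s)" if "s \<in> {0..t}" for N s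
      proof -
        have "norm (A s ** (\<Sum>n<N. picard n s)) \<le> norm (A s) * norm (\<Sum>n<N. picard n s)"
          by (rule norm_matrix_mult_le)
        also have "\<dots> \<le> norm (A s) * D" using that by (intro mult_left_mono psum) auto
        finally show ?thesis by (simp add: mult.commute)
      qed
      show "(\<lambda>N. A s ** (\<Sum>n<N. picard n s)) \<longlonglongrightarrow> A s ** X s" if "s \<in> {0..t}" for s
        using that by (intro bounded_bilinear.tendsto[OF bounded_bilinear_matrix_mult] tendsto_const conv) auto
    qed
    \<comment> \<open>Integration turns each term into the next one, so the sum of the first
      \<open>N\<close> terms becomes the sum of the first \<open>Suc N\<close> terms without the
      initial \<open>mat 1\<close>.\<close>
    have eq: "integral {0..t} (\<lambda>s. A s ** (\<Sum>n<N. picard n s)) = (\<Sum>n<Suc N. picard n t) - mat 1" for N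
    proof -
      have "integral {0..t} (\<lambda>s. A s ** (\<Sum>n<N. picard n s)) = (\<Sum>n<N. picard (Suc n) t)"
        unfolding mult_sum by (subst integral_sum) (auto intro: picard_integrable)
      also have "\<dots> = (\<Sum>n<Suc N. picard n t) - mat 1"
        by (simp only: sum.lessThan_Suc_shift) simp
      finally show ?thesis .
    qed
    note 1 = lim[unfolded eq]
    have 2: "(\<lambda>N. (\<Sum>n<Suc N. picard n t) - mat 1) \<longlonglongrightarrow> X t - mat 1"
      by (intro tendsto_diff tendsto_const LIMSEQ_Suc[OF conv] that)
    show ?thesis using LIMSEQ_unique[OF 2 1] \<open>X 0 = mat 1\<close> by simp
  qed
  with contX \<open>X 0 = mat 1\<close> show ?thesis unfolding solution_def by blast
qed

end

section \<open>Liouville's formula\<close>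

text \<open>A chain rule for increments: \<open>z\<close> moves by \<open>w\<close> up to an error
  that is small compared with the increment of \<open>\<phi>\<close>, and the derivative of
  \<open>F\<close> kills \<open>w\<close>. So \<open>F\<close> changes along \<open>z\<close> only
  by such a small error, as \<open>dini_const\<close> requires.\<close>

lemma eventually_small_comp_derivative:
  fixes F :: "'a::real_normed_vector \<Rightarrow> real"
  assumes F: "(F has_derivative F') (at (z s))" and z: "(z \<longlongrightarrow> z s) (at_right s)"
    and w: "\<forall>\<^sub>F t in at_right s. norm (w t) \<le> C * (\<phi> t - \<phi> s)"
    and F'w: "\<And>t. F' (w t) = 0"
    and step: "\<And>e. e > 0 \<Longrightarrow> \<forall>\<^sub>F t in at_right s. norm (z t - z s - w t) \<le> e * (\<phi> t - \<phi> s)"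
    and "C \<ge> 0" "e > 0"
  shows "\<forall>\<^sub>F t in at_right s. \<bar>F (z t) - F (z s)\<bar> \<le> e * (\<phi> t - \<phi> s :: real)"
proof -
  have lin: "bounded_linear F'" using F by (rule has_derivative_bounded_linear)
  obtain K where K: "K > 0" "\<And>x. norm (F' x) \<le> norm x * K"
    using bounded_linear.pos_bounded[OF lin] by blast
  \<comment> \<open>Using \<open>step\<close> with the constant 1, the increment of \<open>z\<close>
    is at most \<open>C + 1\<close> times that of \<open>\<phi>\<close>. With this \<open>c\<close>
    the linearization error of \<open>F\<close> takes up half of \<open>e\<close>.\<close>
  define c where "c = e / (2 * (C + 1))"
  have "c > 0" using \<open>C \<ge> 0\<close> \<open>e > 0\<close> by (simp add: c_def)
  then obtain d where d: "d > 0"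
    "\<And>y. norm (y - z s) < d \<Longrightarrow> norm (F y - F (z s) - F' (y - z s)) \<le> c * norm (y - z s)"
    using F unfolding has_derivative_at_alt by blast
  have near: "\<forall>\<^sub>F t in at_right s. norm (z t - z s) < d"
    using z \<open>d > 0\<close> by (auto simp: tendsto_iff dist_norm)
  \<comment> \<open>The other half of \<open>e\<close> absorbs the image of the remainder under
    \<open>F'\<close>, whose operator bound is \<open>K\<close>.\<close>
  have "e / (2 * K) > 0" using K \<open>e > 0\<close> by simp
  from step[OF zero_less_one] step[OF this] w near
  show ?thesis
  proof eventually_elim
    case (elim t)
    define \<eta> where "\<eta> = \<phi> t - \<phi> s"
    define r where "r = z t - z s - w t"
    have zt: "z t - z s = w t + r" by (simp add: r_def)
    have "norm (z t - z s) \<le> norm (w t) + norm r"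
      unfolding zt by (rule norm_triangle_ineq)
    then have "norm (z t - z s) \<le> (C + 1) * \<eta>"
      using elim by (simp add: r_def \<eta>_def algebra_simps)
    then have "c * norm (z t - z s) \<le> c * ((C + 1) * \<eta>)"
      using \<open>c > 0\<close> by (intro mult_left_mono) auto
    also have "\<dots> = e / 2 * \<eta>" using \<open>C \<ge> 0\<close> by (simp add: c_def field_simps)
    finally have 1: "\<bar>F (z t) - F (z s) - F' (z t - z s)\<bar> \<le> e / 2 * \<eta>"
      using d(2)[OF elim(4)] by simp
    have "F' (z t - z s) = F' r"
      unfolding zt by (simp add: linear_add[OF bounded_linear.linear[OF lin]] F'w)
    then have "\<bar>F' (z t - z s)\<bar> \<le> norm r * K" using K(2)[of r] by simp
    also have "\<dots> \<le> e / (2 * K) * \<eta> * K"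
      using elim(2) K(1) by (intro mult_right_mono) (auto simp: r_def \<eta>_def)
    also have "\<dots> = e / 2 * \<eta>" using K(1) by simp
    finally have 2: "\<bar>F' (z t - z s)\<bar> \<le> e / 2 * \<eta>" .
    have "\<bar>F (z t) - F (z s)\<bar> \<le> e / 2 * \<eta> + e / 2 * \<eta>" using 1 2 by linarith
    then show ?case by (simp add: \<eta>_def)
  qed
qed

section \<open>The derivative of the determinant\<close>

lemma bounded_linear_entry: "bounded_linear (\<lambda>M::real^'n^'m. M $ i $ j)"
  by (intro bounded_linear_compose[OF bounded_linear_vec_nth] bounded_linear_vec_nth)

lemma bounded_linear_trace: "bounded_linear (trace :: real^'n^'n \<Rightarrow> real)"
  unfolding trace_def by (intro bounded_linear_sum bounded_linear_entry)

lemma has_derivative_det: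
  fixes M :: "real^'n^'n"
  shows "(det has_derivative
    (\<lambda>H. \<Sum>p | p permutes UNIV. of_int (sign p) *
       (\<Sum>i\<in>UNIV. H $ i $ p i * (\<Prod>j\<in>UNIV - {i}. M $ j $ p j)))) (at M)"
  unfolding det_def
  by (intro has_derivative_sum has_derivative_mult_right has_derivative_prod
      bounded_linear_imp_has_derivative bounded_linear_entry)

text \<open>A permutation other than the identity moves at least two points, so after one factor of
  its product is removed, an off-diagonal zero of the identity matrix remains. Only the identity
  permutation contributes.\<close>

lemma has_derivative_det_mat_1:
  "(det has_derivative trace) (at (mat 1 :: real^'n^'n))"
proof -
  have "(\<Sum>p | p permutes (UNIV :: 'n set). of_int (sign p) *
          (\<Sum>i\<in>UNIV. H $ i $ p i * (\<Prod>j\<in>UNIV - {i}. (mat 1 :: real^'n^'n) $ j $ p j)))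
        = trace H" (is "sum ?f _ = _") for H :: "real^'n^'n"
  proof -
    have "sum ?f {p. p permutes UNIV} = sum ?f {id}"
    proof (rule sum.mono_neutral_right)
      show "\<forall>p\<in>{p. p permutes UNIV} - {id}. ?f p = 0"
      proof
        fix p :: "'n \<Rightarrow> 'n" assume p: "p \<in> {p. p permutes UNIV} - {id}"
        have prod0: "(\<Prod>j\<in>UNIV - {i}. (mat 1 :: real^'n^'n) $ j $ p j) = 0" for i
        proof -
          have "\<exists>j. j \<noteq> i \<and> p j \<noteq> j"
          proof (rule ccontr)
            assume "\<not> ?thesis"
            then have fixed: "\<And>j. j \<noteq> i \<Longrightarrow> p j = j" by blast
            have "inj p" using p by (auto dest: permutes_inj)
            then have "p i = i" using fixed by (metis injD)
            with fixed have "p = id" by (metis eq_id_iff)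
            with p show False by simp
          qed
          then obtain j where "j \<in> UNIV - {i}" "(mat 1 :: real^'n^'n) $ j $ p j = 0"
            by (auto simp: mat_def)
          then show ?thesis by (intro prod_zero) auto
        qed
        show "?f p = 0" by (simp only: prod0) simp
      qed
    qed (auto simp: permutes_id)
    also have "\<dots> = trace H" by (simp add: mat_def trace_def)
    finally show ?thesis .
  qed
  with has_derivative_det[of "mat 1 :: real^'n^'n"] show ?thesis by simp
qed

text \<open>Differentiating \<open>det (Z ** M) = det Z * det M\<close> in \<open>Z\<close> at
  \<open>mat 1\<close> in two ways gives both sides, by uniqueness of derivatives. This covers
  singular \<open>M\<close> and avoids the adjugate.\<close>

lemma det_derivative_mult:
  fixes M E :: "real^'n^'n"
  assumes D: "(det has_derivative D) (at M)"
  shows "D (E ** M) = trace E * det M"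
proof -
  have "((\<lambda>Z::real^'n^'n. Z ** M) has_derivative (\<lambda>Z. Z ** M)) (at (mat 1))"
    by (rule bounded_linear_imp_has_derivative)
      (rule bounded_bilinear.bounded_linear_left[OF bounded_bilinear_matrix_mult])
  from has_derivative_compose[OF this, of det D] D
  have "((\<lambda>Z::real^'n^'n. det (Z ** M)) has_derivative (\<lambda>Z. D (Z ** M))) (at (mat 1))" by simp
  moreover have "((\<lambda>Z::real^'n^'n. det (Z ** M)) has_derivative (\<lambda>Z. trace Z * det M)) (at (mat 1))"
    unfolding det_mul by (intro has_derivative_mult_left has_derivative_det_mat_1)
  ultimately have "(\<lambda>Z. D (Z ** M)) = (\<lambda>Z. trace Z * det M)"
    by (rule has_derivative_unique)
  then show ?thesis by meson
qed

section \<open>First-order increments of solutions and the evolution of the determinant\<close>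

context linear_ode
begin

lemma solution_continuous: "solution X \<Longrightarrow> continuous_on {0..T} X"
  unfolding solution_def by (cases "0 \<le> T") auto

lemma solution_eq:
  assumes "solution X" "0 \<le> t"
  shows "X t = X 0 + integral {0..t} (\<lambda>s. A s ** X s)"
proof -
  have "X t - X 0 = integral {0..t} (\<lambda>s. A s ** X s)"
    using assms unfolding solution_def by blast
  then show ?thesis by (metis add_diff_cancel_left' diff_add_cancel add.commute)
qed

lemma solution_mult_integrable: "solution X \<Longrightarrow> (\<lambda>s. A s ** X s) integrable_on {0..T}"
  by (intro set_lebesgue_integral_eq_integral(1)[OF mult_integrable] solution_continuous)

lemma solution_diff:
  assumes X: "solution X" and Y: "solution Y"
  shows "solution (\<lambda>t. X t - Y t)"
proof -
  have "(A s) ** (X s - Y s) = A s ** X s - A s ** Y s" for s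
    by (rule bounded_bilinear.diff_right[OF bounded_bilinear_matrix_mult])
  then have "integral {0..t} (\<lambda>s. A s ** (X s - Y s)) =
      integral {0..t} (\<lambda>s. A s ** X s) - integral {0..t} (\<lambda>s. A s ** Y s)" for t
    using Henstock_Kurzweil_Integration.integral_diff[OF solution_mult_integrable[OF X]
        solution_mult_integrable[OF Y], of t]
    by presburger
  moreover have eqs: "X t - X 0 = integral {0..t} (\<lambda>s. A s ** X s)"
    "Y t - Y 0 = integral {0..t} (\<lambda>s. A s ** Y s)" if "0 \<le> t" for t
    using X Y that unfolding solution_def by blast+
  ultimately have "X t - Y t - (X 0 - Y 0) = integral {0..t} (\<lambda>s. A s ** (X s - Y s))"
    if "0 \<le> t" for t
    by (simp add: that flip: eqs)
  then show ?thesis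
    using solution_continuous[OF X] solution_continuous[OF Y]
    by (simp add: solution_def[of "\<lambda>t. X t - Y t"] continuous_on_diff)
qed

lemma norm_integral_A_le:
  assumes "0 \<le> s" "s \<le> t"
  shows "norm (integral {s..t} A) \<le> \<phi> t - \<phi> s"
proof -
  have "norm (integral {s..t} A) \<le> integral {s..t} (\<lambda>u. norm (A u))"
    by (rule integral_norm_bound_integral[OF set_lebesgue_integral_eq_integral(1)[OF A_integrable_on]
          norm_A_integrable]) (use assms in auto)
  then show ?thesis by (simp only: \<phi>_diff[OF assms])
qed

text \<open>The error is the integral of \<open>A u ** (X u - X s)\<close> over
  \<open>{s..t}\<close>, and right continuity of \<open>X\<close> makes the second factor at most
  \<open>e\<close> near \<open>s\<close>.\<close>

lemma solution_step:
  assumes X: "solution X" and s: "0 \<le> s" and "e > 0"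
  shows "\<forall>\<^sub>F t in at_right s. norm (X t - X s - integral {s..t} A ** X s) \<le> e * (\<phi> t - \<phi> s)"
proof -
  have "(X \<longlongrightarrow> X s) (at_right s)"
    by (rule continuous_on_imp_tendsto_at_right[OF solution_continuous[OF X, of "s+1"] s]) simp
  then have "\<forall>\<^sub>F u in at_right s. norm (X u - X s) < e"
    using \<open>e > 0\<close> by (auto simp: tendsto_iff dist_norm)
  then obtain b where b: "b > s" "\<And>u. s < u \<Longrightarrow> u < b \<Longrightarrow> norm (X u - X s) < e"
    unfolding eventually_at_right_field by blast
  have "\<forall>\<^sub>F t in at_right s. t \<in> {s<..<b}" using b(1) by (rule eventually_at_right_real)
  then show ?thesis
  proof eventually_elim
    case (elim t)
    then have st: "s \<le> t" "t < b" by auto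
    have "0 \<le> t" using s st by simp
    have int1: "(\<lambda>u. A u ** X u) integrable_on {s..t}"
      by (rule integrable_subinterval_real[OF solution_mult_integrable[OF X, of t]]) (use s in auto)
    have intA: "A integrable_on {s..t}"
      using A_integrable_on[OF s] by (rule set_lebesgue_integral_eq_integral(1))
    have bl: "bounded_linear (\<lambda>M::real^'n^'n. M ** X s)"
      by (rule bounded_bilinear.bounded_linear_left[OF bounded_bilinear_matrix_mult])
    have int2: "(\<lambda>u. A u ** X s) integrable_on {s..t}"
      using integrable_linear[OF intA bl] by (simp add: o_def)
    have "X t - X s = integral {s..t} (\<lambda>u. A u ** X u)"
      unfolding solution_eq[OF X s] solution_eq[OF X \<open>0 \<le> t\<close>]
      using Henstock_Kurzweil_Integration.integral_combine[OF s st(1) solution_mult_integrable[OF X]]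
      by (simp add: algebra_simps)
    then have "X t - X s - integral {s..t} A ** X s =
        integral {s..t} (\<lambda>u. A u ** X u) - integral {s..t} (\<lambda>u. A u ** X s)"
      using integral_linear[OF intA bl] by (simp add: o_def)
    also have "\<dots> = integral {s..t} (\<lambda>u. A u ** X u - A u ** X s)"
      using int1 int2 by (rule Henstock_Kurzweil_Integration.integral_diff[symmetric])
    also have "norm \<dots> \<le> integral {s..t} (\<lambda>u. e * norm (A u))"
    proof (rule integral_norm_bound_integral)
      show "(\<lambda>u. A u ** X u - A u ** X s) integrable_on {s..t}"
        using int1 int2 by (rule integrable_diff)
      show "(\<lambda>u. e * norm (A u)) integrable_on {s..t}"
        by (intro integrable_on_mult_right norm_A_integrable s)
      fix u assume u: "u \<in> {s..t}"
      have "norm (X u - X s) \<le> e"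
        using b(2)[of u] u st \<open>e > 0\<close> by (cases "u = s") auto
      then have "norm (A u) * norm (X u - X s) \<le> norm (A u) * e"
        by (rule mult_left_mono) simp
      moreover have "A u ** X u - A u ** X s = A u ** (X u - X s)"
        by (rule bounded_bilinear.diff_right[OF bounded_bilinear_matrix_mult, symmetric])
      ultimately show "norm (A u ** X u - A u ** X s) \<le> e * norm (A u)"
        using norm_matrix_mult_le[of "A u" "X u - X s"] by (simp add: mult.commute)
    qed
    also have "\<dots> = e * (\<phi> t - \<phi> s)" using s st by (simp add: \<phi>_diff)
    finally show ?case .
  qed
qed

text \<open>The product of \<open>det (X t)\<close> and \<open>exp (- p t)\<close> has negligible
  right increments against \<open>\<phi>\<close>, so \<open>dini_const\<close> makes it constant.
  The matrix and the trace integral are paired into one curve \<open>z\<close>, so that a single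
  chain rule applies.\<close>

lemma liouville:
  assumes X: "solution X" and "0 \<le> T"
  shows "det (X T) = det (X 0) * exp (trace (integral {0..T} A))"
proof -
  define p where "p = (\<lambda>t. trace (integral {0..t} A))"
  define F where "F = (\<lambda>z :: (real^'n^'n) \<times> real. det (fst z) * exp (- snd z))"
  define z where "z = (\<lambda>t. (X t, p t))"
  have intA: "A integrable_on {0..t}" for t
    using A_integrable by (rule set_lebesgue_integral_eq_integral(1))
  have "continuous_on {0..T} p"
    unfolding p_def
    by (rule bounded_linear.continuous_on[OF bounded_linear_trace
          indefinite_integral_continuous_1[OF intA]])
  then have contz: "continuous_on {0..T} z"
    unfolding z_def by (rule continuous_on_Pair[OF solution_continuous[OF X]])
  have F_deriv: "(F has_derivative (\<lambda>h. exp (- snd x) * D (fst h) - snd h * exp (- snd x) * det (fst x))) (at x)"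
    if "(det has_derivative D) (at (fst x))" for D x
  proof -
    have "((\<lambda>z. det (fst z)) has_derivative (\<lambda>h. D (fst h))) (at x)"
      using has_derivative_compose[OF has_derivative_fst[OF has_derivative_ident] that] by simp
    note [derivative_intros] = this
    show ?thesis unfolding F_def
      by (auto intro!: derivative_eq_intros simp: algebra_simps)
  qed
  have contF: "continuous_on UNIV F"
    by (intro continuous_at_imp_continuous_on ballI has_derivative_continuous)
      (rule F_deriv[OF has_derivative_det])
  have "F (z T) = F (z 0)"
  proof (rule dini_const[OF \<open>0 \<le> T\<close> _ continuous_on_\<phi>, of "\<lambda>t. F (z t)"])
    show "continuous_on {0..T} (\<lambda>t. F (z t))"
      by (rule continuous_on_compose2[OF contF contz]) simp
    fix s e :: real assume s: "0 \<le> s" "s < T" and "e > 0"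
    obtain D where D: "(det has_derivative D) (at (X s))" using has_derivative_det by blast
    define E where "E t = integral {s..t} A" for t
    \<comment> \<open>This is the first-order increment of \<open>z\<close>. By
      \<open>det_derivative_mult\<close> the determinant and the exponential contribute opposite
      terms along it, so the derivative of \<open>F\<close> vanishes there.\<close>
    define w where "w t = (E t ** X s, trace (E t))" for t
    obtain K where K: "K > 0" "\<And>M :: real^'n^'n. norm (trace M) \<le> norm M * K"
      using bounded_linear.pos_bounded[OF bounded_linear_trace] by blast
    have right: "\<forall>\<^sub>F t in at_right s. t > s" by (simp add: eventually_at_right_less)
    show "\<forall>\<^sub>F t in at_right s. \<bar>F (z t) - F (z s)\<bar> \<le> e * (\<phi> t - \<phi> s)"
    proof (rule eventually_small_comp_derivative[OF F_deriv, of D z s w "norm (X s) + K" \<phi> e])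
      show "(det has_derivative D) (at (fst (z s)))" using D by (simp add: z_def)
      show "(z \<longlongrightarrow> z s) (at_right s)"
        by (rule continuous_on_imp_tendsto_at_right[OF contz s])
      show "exp (- snd (z s)) * D (fst (w t)) - snd (w t) * exp (- snd (z s)) * det (fst (z s)) = 0" for t
        by (simp add: z_def w_def det_derivative_mult[OF D])
      show "\<forall>\<^sub>F t in at_right s. norm (w t) \<le> (norm (X s) + K) * (\<phi> t - \<phi> s)"
        using right
      proof eventually_elim
        case (elim t)
        have "norm (w t) \<le> norm (E t ** X s) + norm (trace (E t))"
          unfolding w_def by (rule norm_Pair_le)
        also have "\<dots> \<le> norm (E t) * norm (X s) + norm (E t) * K"
          by (intro add_mono norm_matrix_mult_le K(2))
        also have "\<dots> = (norm (X s) + K) * norm (E t)" by (simp add: algebra_simps)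
        also have "\<dots> \<le> (norm (X s) + K) * (\<phi> t - \<phi> s)"
          using norm_integral_A_le[of s t] s elim K(1) by (intro mult_left_mono) (auto simp: E_def)
        finally show ?case .
      qed
      fix e :: real assume "e > 0"
      from solution_step[OF X s(1) this] right
      show "\<forall>\<^sub>F t in at_right s. norm (z t - z s - w t) \<le> e * (\<phi> t - \<phi> s)"
      proof eventually_elim
        case (elim t)
        have "integral {0..t} A = integral {0..s} A + E t"
          unfolding E_def
          using Henstock_Kurzweil_Integration.integral_combine[OF s(1) _ intA, of t] elim by simp
        then have "p t = p s + trace (E t)" by (simp add: p_def trace_add)
        \<comment> \<open>The trace integral is exactly additive, so the whole error sits in the
          matrix component, where \<open>solution_step\<close> controls it.\<close>
        then have "z t - z s - w t = (X t - X s - E t ** X s, 0)"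
          by (simp add: z_def w_def)
        then show ?case using elim by (simp add: norm_Pair E_def)
      qed
    qed (use K \<open>e > 0\<close> in auto)
  qed
  then have "det (X T) * exp (- p T) = det (X 0)"
    by (simp add: F_def z_def p_def trace_def)
  then have "det (X T) * exp (- p T) * exp (p T) = det (X 0) * exp (p T)" by simp
  then show ?thesis by (simp add: p_def mult.assoc flip: exp_add)
qed

end

section \<open>Continuous time chains\<close>

lemma absolutely_integrable_matrixI:
  fixes A :: "'a::euclidean_space \<Rightarrow> real^'n^'m"
  assumes "\<And>i j. (\<lambda>t. A t $ i $ j) absolutely_integrable_on S"
  shows "A absolutely_integrable_on S"
  by (subst absolutely_integrable_componentwise_iff)
    (auto simp: Basis_vec_def inner_axis assms)

lemma infnorm_cart_leI:
  fixes x :: "real^'n"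
  shows "(\<And>i. \<bar>x $ i\<bar> \<le> c) \<Longrightarrow> infnorm x \<le> c"
  unfolding infnorm_cart by (rule cSup_least) auto

text \<open>Each component of \<open>P *v x\<close> is a convex combination of the components of
  \<open>x\<close>.\<close>

lemma infnorm_stochastic_le:
  fixes P :: "real^'n^'n"
  assumes nonneg: "\<And>i j. 0 \<le> P $ i $ j" and row: "\<And>i. (\<Sum>j\<in>UNIV. P $ i $ j) = 1"
  shows "infnorm (P *v x) \<le> infnorm x"
proof (rule infnorm_cart_leI)
  fix i
  have "\<bar>(P *v x) $ i\<bar> \<le> (\<Sum>j\<in>UNIV. \<bar>P $ i $ j * x $ j\<bar>)"
    unfolding matrix_vector_mult_def by simp
  also have "\<dots> \<le> (\<Sum>j\<in>UNIV. P $ i $ j * infnorm x)"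
    by (intro sum_mono) (simp add: abs_mult nonneg component_le_infnorm_cart mult_left_mono)
  also have "\<dots> = infnorm x" by (simp add: row flip: sum_distrib_right)
  finally show "\<bar>(P *v x) $ i\<bar> \<le> infnorm x" .
qed

lemma abs_entry_le_norm: "\<bar>M $ i $ j\<bar> \<le> norm M" for M :: "real^'n^'m"
  using Finite_Cartesian_Product.norm_nth_le[of "M $ i" j] Finite_Cartesian_Product.norm_nth_le[of M i]
  by simp

lemma bounded_linear_matrix_vector_mult: "bounded_linear (\<lambda>M::real^'n^'m. M *v v)"
  by (intro linear_conv_bounded_linear[THEN iffD1] linearI)
    (simp_all add: matrix_vector_mult_add_rdistrib scaleR_matrix_vector_assoc)

lemmas tendsto_matrix_vector_mult = bounded_linear.tendsto[OF bounded_linear_matrix_vector_mult]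

lemma isCont_det: "isCont (det :: real^'n^'n \<Rightarrow> real) M"
  using has_derivative_det by (rule has_derivative_continuous)

section \<open>Sup norm contraction and uniqueness of solutions for a chain\<close>

locale chain =
  fixes A :: "real \<Rightarrow> real^'n^'n"
  assumes chain: "continuous_time_chain A"
begin

lemma entry_integrable: "(\<lambda>t. A t $ i $ j) absolutely_integrable_on {0..T}"
  using chain by (cases "0 \<le> T") (auto simp: continuous_time_chain_def)

lemma row_sum: "0 \<le> t \<Longrightarrow> (\<Sum>j\<in>UNIV. A t $ i $ j) = 0"
  using chain by (auto simp: continuous_time_chain_def)

lemma off_diag_nonneg: "0 \<le> t \<Longrightarrow> i \<noteq> j \<Longrightarrow> 0 \<le> A t $ i $ j"
  using chain by (auto simp: continuous_time_chain_def)

sublocale linear_ode A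
  by unfold_locales (intro absolutely_integrable_matrixI entry_integrable)

lemma integral_entry:
  assumes "0 \<le> s"
  shows "((\<lambda>u. A u $ i $ j) has_integral integral {s..t} A $ i $ j) {s..t}"
proof -
  have "(A has_integral integral {s..t} A) {s..t}"
    using A_integrable_on[OF assms] set_lebesgue_integral_eq_integral(1) by blast
  from has_integral_linear[OF this bounded_linear_entry[of i j]] show ?thesis
    by (simp add: o_def)
qed

text \<open>The matrix is stochastic: the integral of \<open>A\<close> inherits zero row sums and
  non-negative off-diagonal entries, and \<open>small\<close> keeps its diagonal entries above or
  equal to -1.\<close>

lemma infnorm_id_plus_integral_le:
  assumes s: "0 \<le> s" "s \<le> t" and small: "\<phi> t - \<phi> s \<le> 1"
  shows "infnorm ((mat 1 + integral {s..t} A) *v x) \<le> infnorm x"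
proof (rule infnorm_stochastic_le)
  define E where "E = integral {s..t} A"
  fix i
  have "((\<lambda>u. \<Sum>j\<in>UNIV. A u $ i $ j) has_integral (\<Sum>j\<in>UNIV. E $ i $ j)) {s..t}"
    unfolding E_def by (intro has_integral_sum integral_entry s) simp
  moreover have "((\<lambda>u. \<Sum>j\<in>UNIV. A u $ i $ j) has_integral 0) {s..t}"
    by (rule has_integral_eq[OF _ has_integral_0]) (use s in \<open>simp add: row_sum\<close>)
  ultimately have "(\<Sum>j\<in>UNIV. E $ i $ j) = 0" by (rule has_integral_unique)
  then show "(\<Sum>j\<in>UNIV. (mat 1 + E) $ i $ j) = 1"
    by (simp add: sum.distrib mat_def)
  fix j
  show "0 \<le> (mat 1 + E) $ i $ j"
  proof (cases "i = j")
    case True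
    have "\<bar>E $ i $ j\<bar> \<le> 1"
      using abs_entry_le_norm[of E i j] norm_integral_A_le[OF s] small by (simp add: E_def)
    with True show ?thesis by (simp add: mat_def)
  next
    case False
    then have "0 \<le> E $ i $ j"
      unfolding E_def by (intro has_integral_nonneg[OF integral_entry[OF s(1)]])
        (use s in \<open>auto simp: off_diag_nonneg\<close>)
    with False show ?thesis by (simp add: mat_def)
  qed
qed

text \<open>Over a short interval \<open>X t\<close> is a stochastic matrix times \<open>X s\<close>
  plus a remainder \<open>R\<close> that is small against the increment of \<open>\<phi>\<close>.
  The first part does not raise the sup norm, and \<open>dini_antimono\<close> disposes of the
  remainder.\<close>

lemma infnorm_solution_antimono:
  assumes X: "solution X" and ab: "0 \<le> a" "a \<le> b"
  shows "infnorm (X b *v v) \<le> infnorm (X a *v v)"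
proof (rule dini_antimono[OF ab(2), of "\<lambda>t. infnorm (X t *v v)" \<phi>])
  have X_cont: "continuous_on {a..b} X"
    by (rule continuous_on_subset[OF solution_continuous[OF X, of b]]) (use ab in auto)
  show "continuous_on {a..b} (\<lambda>t. infnorm (X t *v v))"
    by (intro continuous_on_infnorm
        bounded_linear.continuous_on[OF bounded_linear_matrix_vector_mult X_cont])
  show "continuous_on {a..b} \<phi>"
    by (rule continuous_on_subset[OF continuous_on_\<phi>[of b]]) (use ab in auto)
  fix s e :: real assume s: "a \<le> s" "s < b" and "e > 0"
  with ab have "0 \<le> s" by simp
  have "(\<phi> \<longlongrightarrow> \<phi> s) (at_right s)"
    by (rule continuous_on_imp_tendsto_at_right[OF continuous_on_\<phi> \<open>0 \<le> s\<close> s(2)])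
  then have near: "\<forall>\<^sub>F t in at_right s. \<phi> t < \<phi> s + 1"
    by (rule order_tendstoD(2)) simp
  have right: "\<forall>\<^sub>F t in at_right s. t > s" by (rule eventually_at_right_less)
  \<comment> \<open>Rescales \<open>e\<close> by the size of \<open>v\<close>; the summand 1 covers
    \<open>v = 0\<close>.\<close>
  define d where "d = e / (norm v + 1)"
  have "d > 0" using \<open>e > 0\<close> by (simp add: d_def add_nonneg_pos)
  from solution_step[OF X \<open>0 \<le> s\<close> this] near right
  show "\<forall>\<^sub>F t in at_right s. infnorm (X t *v v) - infnorm (X s *v v) \<le> e * (\<phi> t - \<phi> s)"
  proof eventually_elim
    case (elim t)
    define E where "E = integral {s..t} A"
    define R where "R = X t - X s - E ** X s"
    have "X t = (mat 1 + E) ** X s + R"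
      by (simp add: R_def bounded_bilinear.add_left[OF bounded_bilinear_matrix_mult])
    then have "X t *v v = (mat 1 + E) *v (X s *v v) + R *v v"
      by (simp add: matrix_vector_mult_add_rdistrib matrix_vector_mul_assoc)
    then have "infnorm (X t *v v) \<le> infnorm ((mat 1 + E) *v (X s *v v)) + infnorm (R *v v)"
      by (simp add: infnorm_triangle)
    moreover have "infnorm ((mat 1 + E) *v (X s *v v)) \<le> infnorm (X s *v v)"
      unfolding E_def using elim \<open>0 \<le> s\<close> by (intro infnorm_id_plus_integral_le) auto
    moreover have "infnorm (R *v v) \<le> e * (\<phi> t - \<phi> s)"
    proof -
      have mono: "0 \<le> \<phi> t - \<phi> s" using \<phi>_mono[OF \<open>0 \<le> s\<close>, of t] elim by simp
      have "infnorm (R *v v) \<le> norm R * norm v"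
        by (rule order_trans[OF infnorm_le_norm norm_matrix_vector_mult_le])
      also have "\<dots> \<le> (d * (\<phi> t - \<phi> s)) * (norm v + 1)"
        using elim \<open>d > 0\<close> mono by (intro mult_mono) (auto simp: R_def E_def)
      also have "\<dots> = e * (\<phi> t - \<phi> s)"
      proof -
        have "d * (norm v + 1) = e"
          using add_nonneg_pos[OF norm_ge_zero[of v] zero_less_one] by (simp add: d_def)
        then show ?thesis by (simp add: mult.commute mult.left_commute)
      qed
      finally show ?thesis .
    qed
    ultimately show ?case by simp
  qed
qed

text \<open>The sup norm contraction takes the place of a Gronwall argument: the difference of the
  solutions starts at 0, so its action on every vector stays 0.\<close>

lemma solution_unique:
  assumes X: "solution X" and Y: "solution Y" and "X 0 = Y 0" "0 \<le> t"
  shows "X t = Y t"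
proof -
  have "infnorm ((X t - Y t) *v v) \<le> 0" for v
    using infnorm_solution_antimono[OF solution_diff[OF X Y] _ \<open>0 \<le> t\<close>, of v] assms(3)
    by (simp add: infnorm_0)
  then have "(X t - Y t) *v v = 0" for v
    using infnorm_pos_le[of "(X t - Y t) *v v"] infnorm_eq_0[of "(X t - Y t) *v v"]
    by (meson order_antisym)
  then have "X t - Y t = 0"
    by (simp add: matrix_eq)
  then show ?thesis by simp
qed

section \<open>Identification of the state transition matrix\<close>

lemma fundamental_solution_iff:
  "fundamental_solution A 0 X \<longleftrightarrow> solution X \<and> X 0 = mat 1"
proof
  assume X: "fundamental_solution A 0 X"
  then have int: "((\<lambda>s. A s ** X s) has_integral (X t - mat 1)) {0..t}" if "0 \<le> t" for t
    using that unfolding fundamental_solution_def by blast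
  \<comment> \<open>The initial condition is implicit in \<open>fundamental_solution\<close>: at
    time 0 the integral runs over a single point and vanishes.\<close>
  have "X 0 - mat 1 = 0"
    by (rule has_integral_unique[OF int[OF order_refl]]) (simp add: has_integral_refl)
  then have X0: "X 0 = mat 1" by simp
  moreover have "solution X"
    unfolding solution_def
  proof (intro allI impI conjI)
    fix t :: real assume "0 \<le> t"
    then show "continuous_on {0..t} X"
      using X continuous_on_subset[of "{0..}" X "{0..t}"] by (simp add: fundamental_solution_def)
    show "X t - X 0 = integral {0..t} (\<lambda>s. A s ** X s)"
      unfolding X0 by (rule integral_unique[OF int[OF \<open>0 \<le> t\<close>], symmetric])
  qed
  ultimately show "solution X \<and> X 0 = mat 1" by simp
next
  assume X: "solution X \<and> X 0 = mat 1"
  show "fundamental_solution A 0 X"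
    unfolding fundamental_solution_def continuous_on_atLeast_iff
  proof (intro allI impI conjI)
    fix t :: real assume "0 \<le> t"
    show "continuous_on {0..t} X" using X solution_continuous by blast
    have "X t - mat 1 = integral {0..t} (\<lambda>s. A s ** X s)"
      using solution_eq[of X t] X \<open>0 \<le> t\<close> by simp
    then show "((\<lambda>s. A s ** X s) has_integral (X t - mat 1)) {0..t}"
      using integrable_integral[OF solution_mult_integrable[of X t]] X by simp
  qed
qed

lemma state_transition_eq:
  assumes X: "solution X" "X 0 = mat 1" and "0 \<le> t"
  shows "state_transition A t 0 = X t"
  unfolding state_transition_def fundamental_solution_iff
proof (rule the_equality)
  show "\<exists>Y. (solution Y \<and> Y 0 = mat 1) \<and> X t = Y t" by (intro exI[of _ X] conjI X refl)
  fix M assume "\<exists>Y. (solution Y \<and> Y 0 = mat 1) \<and> M = Y t"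
  then obtain Y where "solution Y" "Y 0 = mat 1" "M = Y t" by blast
  then show "M = X t" using solution_unique[of Y X t] X \<open>0 \<le> t\<close> by simp
qed

lemma null_at_iff:
  assumes X: "solution X" "X 0 = mat 1"
  shows "v \<in> null_at A 0 \<longleftrightarrow> ((\<lambda>t. X t *v v) \<longlongrightarrow> 0) at_top"
proof -
  have "\<forall>\<^sub>F t in at_top. state_transition A t 0 *v v = X t *v v"
    using eventually_ge_at_top[of 0] by eventually_elim (simp add: state_transition_eq[OF X])
  from tendsto_cong[OF this] show ?thesis by (simp add: null_at_def)
qed

section \<open>The null space and the determinant\<close>

lemma bounded_solution:
  assumes X: "solution X"
  shows "bounded (X ` {0..})"
proof -
  \<comment> \<open>Column \<open>j\<close> of \<open>X t\<close> is the image of a unit vector,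
    whose sup norm is largest at time 0.\<close>
  have entry: "\<bar>X t $ i $ j\<bar> \<le> infnorm (X 0 *v axis j 1)" if "0 \<le> t" for t i j
  proof -
    have "X t $ i $ j = (X t *v axis j 1) $ i"
      by (simp add: matrix_vector_mult_basis column_def)
    then have "\<bar>X t $ i $ j\<bar> \<le> infnorm (X t *v axis j 1)"
      using component_le_infnorm_cart by metis
    also have "\<dots> \<le> infnorm (X 0 *v axis j 1)"
      by (rule infnorm_solution_antimono[OF X _ that]) simp
    finally show ?thesis .
  qed
  have "norm (X t) \<le> (\<Sum>i\<in>(UNIV::'n set). \<Sum>j\<in>(UNIV::'n set). infnorm (X 0 *v axis j 1))" if "0 \<le> t" for t
  proof -
    have "norm (X t) \<le> (\<Sum>i\<in>UNIV. norm (X t $ i))"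
      unfolding norm_vec_def[of "X t"] by (rule L2_set_le_sum) simp
    also have "\<dots> \<le> (\<Sum>i\<in>UNIV. \<Sum>j\<in>UNIV. \<bar>X t $ i $ j\<bar>)"
      by (intro sum_mono norm_le_l1_cart)
    also have "\<dots> \<le> (\<Sum>i\<in>(UNIV::'n set). \<Sum>j\<in>(UNIV::'n set). infnorm (X 0 *v axis j 1))"
      by (intro sum_mono entry that)
    finally show ?thesis .
  qed
  then show ?thesis unfolding bounded_iff by auto
qed

text \<open>The sup norm is a Lyapunov function, so one sequence of times suffices to detect the
  null space.\<close>

lemma tendsto_zero_if_subsequence:
  assumes X: "solution X" and \<tau>: "\<And>k. 0 \<le> \<tau> k" and lim: "(\<lambda>k. X (\<tau> k) *v v) \<longlonglongrightarrow> 0"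
  shows "((\<lambda>t. X t *v v) \<longlongrightarrow> 0) at_top"
proof -
  have "((\<lambda>t. infnorm (X t *v v)) \<longlongrightarrow> 0) at_top"
  proof (rule tendstoI)
    fix e :: real assume "e > 0"
    have "(\<lambda>k. infnorm (X (\<tau> k) *v v)) \<longlonglongrightarrow> 0"
      using tendsto_infnorm[OF lim] by (simp add: infnorm_0)
    then have "\<forall>\<^sub>F k in sequentially. infnorm (X (\<tau> k) *v v) < e"
      using \<open>e > 0\<close> by (rule order_tendstoD(2))
    then obtain k where k: "infnorm (X (\<tau> k) *v v) < e"
      using eventually_happens'[OF sequentially_bot] by blast
    show "\<forall>\<^sub>F t in at_top. dist (infnorm (X t *v v)) 0 < e"
      using eventually_ge_at_top[of "\<tau> k"]
    proof eventually_elim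
      case (elim t)
      from infnorm_solution_antimono[OF X \<tau> this, of v] k show ?case
        by (simp add: infnorm_pos_le)
    qed
  qed
  from tendsto_mult_right_zero[OF this, of "sqrt DIM(real^'n)"]
  show ?thesis
    by (rule Lim_null_comparison[rotated]) (intro always_eventually allI norm_le_infnorm)
qed

text \<open>Both directions pass to a limit point \<open>P\<close> of the bounded curve
  \<open>X\<close>. If the determinant has no positive lower bound, some \<open>P\<close> is
  singular and its kernel lies in the null space; conversely a null vector is killed by every limit
  at infinity, whose determinant is still at least \<open>c\<close>.\<close>

lemma null_trivial_iff_det_bounded:
  assumes X: "solution X" "X 0 = mat 1"
  shows "null_at A 0 \<subseteq> {0} \<longleftrightarrow> (\<exists>c>0. \<forall>t\<ge>0. c \<le> det (X t))"
proof
  assume null: "null_at A 0 \<subseteq> {0}"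
  show "\<exists>c>0. \<forall>t\<ge>0. c \<le> det (X t)"
  proof (rule ccontr)
    assume neg: "\<not> ?thesis"
    \<comment> \<open>The chosen times are merely non-negative;
      \<open>tendsto_zero_if_subsequence\<close> accepts any such sequence.\<close>
    have "\<exists>t\<ge>0. det (X t) < 1 / Suc k" for k
      using neg by (metis not_le of_nat_0_less_iff zero_less_Suc zero_less_divide_1_iff)
    then obtain \<tau> where \<tau>: "\<And>k. 0 \<le> \<tau> k" "\<And>k. det (X (\<tau> k)) < 1 / Suc k" by metis
    have "bounded (range (\<lambda>k. X (\<tau> k)))"
      by (rule bounded_subset[OF bounded_solution[OF X(1)]]) (use \<tau>(1) in auto)
    then obtain P r where r: "strict_mono r" "(\<lambda>k. X (\<tau> (r k))) \<longlonglongrightarrow> P"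
      using bounded_imp_convergent_subsequence[of "\<lambda>k. X (\<tau> k)"] by (auto simp: o_def)
    have "(\<lambda>k. det (X (\<tau> (r k)))) \<longlonglongrightarrow> det P"
      using isCont_tendsto_compose[OF isCont_det r(2)] .
    moreover have "(\<lambda>k. det (X (\<tau> (r k)))) \<longlonglongrightarrow> 0"
    proof (rule real_tendsto_sandwich[OF _ _ tendsto_const])
      \<comment> \<open>The lower bound comes from Liouville's formula, which makes the determinant
        an exponential.\<close>
      show "\<forall>\<^sub>F k in sequentially. 0 \<le> det (X (\<tau> (r k)))"
        using liouville[OF X(1) \<tau>(1)] X(2) by (simp add: det_I)
      show "\<forall>\<^sub>F k in sequentially. det (X (\<tau> (r k))) \<le> 1 / real (Suc (r k))"
        using \<tau>(2) by (intro always_eventually allI less_imp_le)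
      have "(\<lambda>k. 1 / real (Suc k)) \<longlonglongrightarrow> 0" by (rule LIMSEQ_Suc[OF lim_1_over_n])
      from LIMSEQ_subseq_LIMSEQ[OF this r(1)]
      show "(\<lambda>k. 1 / real (Suc (r k))) \<longlonglongrightarrow> 0" by (simp add: o_def)
    qed
    ultimately have "det P = 0" by (rule LIMSEQ_unique)
    then obtain v where v: "v \<noteq> 0" "P *v v = 0"
      by (metis invertible_det_nz invertible_left_inverse matrix_left_invertible_ker)
    have "(\<lambda>k. X (\<tau> (r k)) *v v) \<longlonglongrightarrow> 0"
      using tendsto_matrix_vector_mult[OF r(2), of v] v by simp
    from tendsto_zero_if_subsequence[OF X(1) \<tau>(1) this] have "v \<in> null_at A 0"
      by (simp add: null_at_iff[OF X])
    with null v show False by auto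
  qed
next
  assume "\<exists>c>0. \<forall>t\<ge>0. c \<le> det (X t)"
  then obtain c where c: "c > 0" "\<And>t. t \<ge> 0 \<Longrightarrow> c \<le> det (X t)" by blast
  show "null_at A 0 \<subseteq> {0}"
  proof
    fix v assume "v \<in> null_at A 0"
    then have lim: "((\<lambda>t. X t *v v) \<longlongrightarrow> 0) at_top" by (simp add: null_at_iff[OF X])
    have "bounded (range (\<lambda>k. X (real k)))"
      by (rule bounded_subset[OF bounded_solution[OF X(1)]]) auto
    then obtain P r where r: "strict_mono r" "(\<lambda>k. X (real (r k))) \<longlonglongrightarrow> P"
      using bounded_imp_convergent_subsequence[of "\<lambda>k. X (real k)"] by (auto simp: o_def)
    have "filterlim (\<lambda>k. real (r k)) at_top sequentially"
      by (rule filterlim_compose[OF filterlim_real_sequentially filterlim_subseq[OF r(1)]])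
    from filterlim_compose[OF lim this] have "(\<lambda>k. X (real (r k)) *v v) \<longlonglongrightarrow> 0" .
    with tendsto_matrix_vector_mult[OF r(2), of v] have "P *v v = 0" by (rule LIMSEQ_unique)
    moreover have "c \<le> det P"
      using isCont_tendsto_compose[OF isCont_det r(2)]
      by (rule tendsto_lowerbound) (auto intro!: always_eventually c(2))
    ultimately show "v \<in> {0}"
      using \<open>c > 0\<close> by (metis invertible_det_nz invertible_left_inverse matrix_left_invertible_ker
          insertI1 less_irrefl not_le)
  qed
qed

text \<open>Each diagonal entry is minus the sum of the non-negative off-diagonal entries in its
  row. It thus dominates its row in absolute value, and the negated trace adds up these non-negative
  quantities.\<close>

lemma abs_entry_le_trace:
  assumes "0 \<le> t"
  shows "\<bar>A t $ i $ j\<bar> \<le> - trace (A t)"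
proof -
  have off: "A t $ k $ k = - (\<Sum>l\<in>UNIV-{k}. A t $ k $ l)" for k
    using row_sum[OF assms, of k] by (simp add: sum.remove[of UNIV k])
  have diag: "A t $ k $ k \<le> 0" for k
    unfolding off by (auto intro!: sum_nonneg off_diag_nonneg assms)
  have "\<bar>A t $ i $ j\<bar> \<le> - A t $ i $ i"
  proof (cases "i = j")
    case False
    then have "A t $ i $ j \<le> (\<Sum>l\<in>UNIV-{i}. A t $ i $ l)"
      by (intro member_le_sum) (auto intro: off_diag_nonneg assms)
    with False show ?thesis using off[of i] off_diag_nonneg[OF assms False] by simp
  qed (use diag in simp)
  also have "\<dots> \<le> (\<Sum>k\<in>UNIV. - A t $ k $ k)"
    by (rule member_le_sum) (use diag in auto)
  finally show ?thesis by (simp add: trace_def sum_negf)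
qed

end

section \<open>Integrability of the chain in terms of its trace\<close>

lemma max_norm_eq: "max_norm M = Max (range (\<lambda>p. \<bar>M $ fst p $ snd p\<bar>))"
proof -
  have "{\<bar>M $ i $ j\<bar> | i j. True} = range (\<lambda>p. \<bar>M $ fst p $ snd p\<bar>)"
    by (auto simp: image_iff) (metis fst_conv snd_conv)
  then show ?thesis by (simp add: max_norm_def)
qed

lemma max_norm_le_iff: "max_norm M \<le> c \<longleftrightarrow> (\<forall>i j. \<bar>M $ i $ j\<bar> \<le> c)"
  unfolding max_norm_eq by (subst Max_le_iff) auto

lemma measurable_max_norm:
  assumes "\<And>i j. (\<lambda>t. f t $ i $ j) \<in> borel_measurable M"
  shows "(\<lambda>t. max_norm (f t)) \<in> borel_measurable M"
  unfolding max_norm_eq by (intro borel_measurable_Max borel_measurable_abs assms) simp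

lemma max_norm_nonneg: "0 \<le> max_norm M"
  using max_norm_le_iff[of M "max_norm M"] by (meson abs_ge_zero order_refl order_trans)

context chain
begin

lemma integral_neg_trace:
  "((\<lambda>u. - trace (A u)) has_integral - trace (integral {0..t} A)) {0..t}"
proof -
  have "(A has_integral integral {0..t} A) {0..t}"
    using A_integrable set_lebesgue_integral_eq_integral(1) by blast
  from has_integral_neg[OF has_integral_linear[OF this bounded_linear_trace]] show ?thesis
    by (simp add: o_def)
qed

lemma max_norm_le_trace: "0 \<le> t \<Longrightarrow> max_norm (A t) \<le> - trace (A t)"
  by (simp add: max_norm_le_iff abs_entry_le_trace)

lemma neg_trace_le_max_norm: "- trace (A t) \<le> real CARD('n) * max_norm (A t)"
proof -
  have entry: "\<bar>A t $ i $ j\<bar> \<le> max_norm (A t)" for i j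
    using max_norm_le_iff[of "A t" "max_norm (A t)"] by simp
  have "- trace (A t) \<le> (\<Sum>i\<in>(UNIV::'n set). max_norm (A t))"
    unfolding trace_def sum_negf[symmetric]
    by (intro sum_mono) (metis abs_le_D2 entry)
  then show ?thesis by simp
qed

text \<open>Measurability comes from the entries, and the dominating function is the negated trace,
  integrable as a linear image of \<open>A\<close>.\<close>

lemma max_norm_integrable: "(\<lambda>t. max_norm (A t)) absolutely_integrable_on {0..T}"
proof (rule measurable_bounded_by_integrable_imp_absolutely_integrable)
  show "(\<lambda>t. max_norm (A t)) \<in> borel_measurable (lebesgue_on {0..T})"
    by (intro measurable_max_norm absolutely_integrable_imp_borel_measurable entry_integrable) simp
  show "(\<lambda>t. - trace (A t)) integrable_on {0..T}"
    using integral_neg_trace by (rule has_integral_integrable)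
  show "norm (max_norm (A t)) \<le> - trace (A t)" if "t \<in> {0..T}" for t
    using max_norm_le_trace[of t] that by (simp add: max_norm_nonneg)
qed simp

text \<open>The maximum norm and the negated trace bound each other up to the factor
  \<open>CARD('n)\<close>. For the non-negative negated trace, bounded partial integrals are enough
  by monotone convergence.\<close>

lemma max_norm_integrable_iff:
  "(\<lambda>t. max_norm (A t)) absolutely_integrable_on {0..} \<longleftrightarrow>
     (\<exists>B. \<forall>t\<ge>0. - trace (integral {0..t} A) \<le> B)"
proof
  assume "(\<lambda>t. max_norm (A t)) absolutely_integrable_on {0..}"
  then have int: "(\<lambda>t. max_norm (A t)) integrable_on {0..}"
    by (rule set_lebesgue_integral_eq_integral(1))
  have "- trace (integral {0..t} A) \<le> real CARD('n) * integral {0..} (\<lambda>t. max_norm (A t))" for t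
  proof -
    have intt: "(\<lambda>t. max_norm (A t)) integrable_on {0..t}"
      using max_norm_integrable by (rule set_lebesgue_integral_eq_integral(1))
    have "- trace (integral {0..t} A) \<le> real CARD('n) * integral {0..t} (\<lambda>t. max_norm (A t))"
      by (rule has_integral_le[OF integral_neg_trace
            has_integral_mult_right[OF integrable_integral[OF intt]]])
        (rule neg_trace_le_max_norm)
    also have "\<dots> \<le> real CARD('n) * integral {0..} (\<lambda>t. max_norm (A t))"
      by (intro mult_left_mono integral_subset_le intt int) (auto simp: max_norm_nonneg)
    finally show ?thesis .
  qed
  then show "\<exists>B. \<forall>t\<ge>0. - trace (integral {0..t} A) \<le> B" by blast
next
  assume "\<exists>B. \<forall>t\<ge>0. - trace (integral {0..t} A) \<le> B"
  then obtain B where B: "\<And>t. 0 \<le> t \<Longrightarrow> - trace (integral {0..t} A) \<le> B" by blast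
  \<comment> \<open>Truncation to \<open>{0..real k}\<close> turns integrals over bounded intervals
    into integrals over the fixed half line, as the convergence theorems require.\<close>
  define cut :: "(real \<Rightarrow> real) \<Rightarrow> nat \<Rightarrow> real \<Rightarrow> real"
    where "cut f k = (\<lambda>t. if t \<in> {0..real k} then f t else 0)" for f k
  have cut_lim: "(\<lambda>k. cut f k t) \<longlonglongrightarrow> f t" if "t \<in> {0..}" for f t
  proof (rule tendsto_eventually)
    have "\<forall>\<^sub>F k in sequentially. t \<le> real k"
      using filterlim_real_sequentially by (simp add: filterlim_at_top)
    then show "\<forall>\<^sub>F k in sequentially. cut f k t = f t"
      by eventually_elim (use that in \<open>simp add: cut_def\<close>)
  qed
  define q where "q = (\<lambda>t. - trace (A t))"
  \<comment> \<open>Any pair of indices serves here, since the bound dominates an absolute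
    value.\<close>
  have q_nonneg: "0 \<le> q t" if "0 \<le> t" for t
    using abs_entry_le_trace[OF that, of undefined undefined] by (simp add: q_def)
  have cut_q: "(cut q k has_integral - trace (integral {0..real k} A)) {0..}" for k
    unfolding cut_def using integral_neg_trace[of "real k"]
    by (subst has_integral_restrict) (auto simp: q_def)
  have q_int: "q integrable_on {0..}"
  proof (rule conjunct1[OF monotone_convergence_increasing[of "cut q"]])
    show "cut q k integrable_on {0..}" for k
      using cut_q by (rule has_integral_integrable)
    show "cut q k t \<le> cut q (Suc k) t" if "t \<in> {0..}" for k t
      using that q_nonneg[of t] by (simp add: cut_def)
    show "bounded (range (\<lambda>k. integral {0..} (cut q k)))"
    proof -
      have "0 \<le> - trace (integral {0..real k} A)" for k
        by (rule has_integral_nonneg[OF integral_neg_trace])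
          (use q_nonneg in \<open>auto simp: q_def\<close>)
      then have "norm (integral {0..} (cut q k)) \<le> B" for k
        unfolding integral_unique[OF cut_q] using B[of "real k"] by simp
      then show ?thesis by (intro boundedI[of _ B]) auto
    qed
  qed (rule cut_lim)
  \<comment> \<open>Integrability passes from \<open>q\<close> to the smaller maximum norm by
    dominated convergence of the truncations.\<close>
  have "(\<lambda>t. max_norm (A t)) integrable_on {0..}"
  proof (rule dominated_convergence_integrable[where f = "cut (\<lambda>t. max_norm (A t))"])
    show "cut (\<lambda>t. max_norm (A t)) k absolutely_integrable_on {0..}" for k
    proof (rule nonnegative_absolutely_integrable_1)
      have "(\<lambda>t. max_norm (A t)) integrable_on {0..real k}"
        using max_norm_integrable by (rule set_lebesgue_integral_eq_integral(1))
      from integrable_integral[OF this]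
      have "(cut (\<lambda>t. max_norm (A t)) k has_integral
              integral {0..real k} (\<lambda>t. max_norm (A t))) {0..}"
        unfolding cut_def by (subst has_integral_restrict) auto
      then show "cut (\<lambda>t. max_norm (A t)) k integrable_on {0..}"
        by (rule has_integral_integrable)
    qed (simp add: cut_def max_norm_nonneg)
    show "norm (max_norm (A t)) \<le> q t" if "t \<in> {0..}" for t
      using max_norm_le_trace[of t] that by (simp add: max_norm_nonneg q_def)
  qed (fact q_int, rule cut_lim)
  then show "(\<lambda>t. max_norm (A t)) absolutely_integrable_on {0..}"
    by (rule nonnegative_absolutely_integrable_1) (simp add: max_norm_nonneg)
qed

text \<open>By Liouville's formula the determinant is the exponential of the trace integral. A lower
  bound \<open>c\<close> turns into the upper bound \<open>- ln c\<close>, and \<open>B\<close> into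
  \<open>exp (- B)\<close>.\<close>

lemma det_bounded_iff:
  assumes X: "solution X" "X 0 = mat 1"
  shows "(\<exists>c>0. \<forall>t\<ge>0. c \<le> det (X t)) \<longleftrightarrow> (\<exists>B. \<forall>t\<ge>0. - trace (integral {0..t} A) \<le> B)"
proof -
  have det: "det (X t) = exp (trace (integral {0..t} A))" if "0 \<le> t" for t
    using liouville[OF X(1) that] X(2) by (simp add: det_I)
  have det_pos: "0 < det (X t)" if "0 \<le> t" for t
    by (simp add: det that)
  show ?thesis
  proof
    assume "\<exists>c>0. \<forall>t\<ge>0. c \<le> det (X t)"
    then obtain c where "c > 0" "\<And>t. 0 \<le> t \<Longrightarrow> c \<le> det (X t)" by blast
    then have "- trace (integral {0..t} A) \<le> - ln c" if "0 \<le> t" for t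
      using that ln_le_cancel_iff[of c "det (X t)"] det_pos[OF that] by (simp add: det)
    then show "\<exists>B. \<forall>t\<ge>0. - trace (integral {0..t} A) \<le> B" by blast
  next
    assume "\<exists>B. \<forall>t\<ge>0. - trace (integral {0..t} A) \<le> B"
    then obtain B where B: "\<And>t. 0 \<le> t \<Longrightarrow> - trace (integral {0..t} A) \<le> B" by blast
    have "exp (- B) \<le> det (X t)" if "0 \<le> t" for t
      using B[OF that] by (simp add: det that)
    then show "\<exists>c>0. \<forall>t\<ge>0. c \<le> det (X t)" using exp_gt_zero by blast
  qed
qed

end

theorem theorem5:
  fixes A :: "real \<Rightarrow> real^'n^'n"
  assumes "continuous_time_chain A"
  shows "chain_rank A = CARD('n) \<longleftrightarrow> l1_approximation A neutral_chain"
proof -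
  interpret chain A using assms by unfold_locales
  obtain X where X: "solution X" "X 0 = mat 1" using solution_exists by blast
  \<comment> \<open>The subtraction in \<open>chain_rank\<close> is truncated, but
    \<open>CARD('n)\<close> is positive, so the value \<open>CARD('n)\<close> still forces nullity
    0.\<close>
  have "chain_rank A = CARD('n) \<longleftrightarrow> dim (null_at A 0) = 0"
    unfolding chain_rank_def nullity_def using zero_less_card_finite[where 'a = 'n] by linarith
  also have "\<dots> \<longleftrightarrow> null_at A 0 \<subseteq> {0}" by (rule dim_eq_0)
  also have "\<dots> \<longleftrightarrow> (\<exists>B. \<forall>t\<ge>0. - trace (integral {0..t} A) \<le> B)"
    using null_trivial_iff_det_bounded[OF X] det_bounded_iff[OF X] by simp
  also have "\<dots> \<longleftrightarrow> l1_approximation A neutral_chain"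
    using max_norm_integrable_iff by (simp add: l1_approximation_def neutral_chain_def)
  finally show ?thesis .
qed

end
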